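(* Assume the Continuum Hypothesis. Then there exists a compact, separable Hausdorff space which is van der Waerden but not Hindman.
   Context: $\omega=\{0,1,2,\dots\}$. A set $A\subseteq\omega$ is an AP-set if it contains arithmetic progressions of every finite length. For $B\subseteq\omega$, $FS(B)$ denotes the set of all sums $\sum_{n\in F}n$ over nonempty finite subsets $F\subseteq B$. A Hausdorff space $X$ is van der Waerden if for every sequence $(x_n)_{n\in\omega}$ in $X$ there is an AP-set $A\subseteq\omega$ such that the subsequence $(x_n)_{n\in A}$ converges. A sequence $(x_n)_{n\in FS(B)}$ ($B\subseteq\omega$ infinite) IP-converges to $x$ if for every neighborhood $U$ of $x$ there is $n_0$ with $\{x_n:n\in FS(B\setminus\{0,\dots,n_0-1\})\}\subseteq U$. A Hausdorff space $X$ is Hindman if for every sequence $(x_n)_{n\in\omega}$ in $X$ there is an infinite $B\subseteq\omega$ such that $(x_n)_{n\in FS(B)}$ IP-converges to some point of $X$. *)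

theory Defs
  imports "HOL-Analysis.Analysis" "HOL-Library.Equipollence"
begin

definition CH :: bool where
  "CH \<longleftrightarrow> (\<forall>A :: real set. countable A \<or> A \<approx> (UNIV :: real set))"

definition AP_set :: "nat set \<Rightarrow> bool" where
  "AP_set A \<longleftrightarrow> (\<forall>k. \<exists>a d. d > 0 \<and> (\<forall>i<k. a + i * d \<in> A))"

definition FS :: "nat set \<Rightarrow> nat set" where
  "FS B = {\<Sum>F | F. F \<subseteq> B \<and> finite F \<and> F \<noteq> {}}"

definition subseq_converges_to ::
    "'a topology \<Rightarrow> (nat \<Rightarrow> 'a) \<Rightarrow> nat set \<Rightarrow> 'a \<Rightarrow> bool" where
  "subseq_converges_to X x A l \<longleftrightarrow> l \<in> topspace X \<and>
     (\<forall>U. openin X U \<and> l \<in> U \<longrightarrow> finite {n \<in> A. x n \<notin> U})"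

definition IP_converges_to ::
    "'a topology \<Rightarrow> (nat \<Rightarrow> 'a) \<Rightarrow> nat set \<Rightarrow> 'a \<Rightarrow> bool" where
  "IP_converges_to X x B l \<longleftrightarrow> l \<in> topspace X \<and>
     (\<forall>U. openin X U \<and> l \<in> U \<longrightarrow>
        (\<exists>n0. \<forall>m \<in> FS (B - {0..<n0}). x m \<in> U))"

definition van_der_Waerden_space :: "'a topology \<Rightarrow> bool" where
  "van_der_Waerden_space X \<longleftrightarrow> Hausdorff_space X \<and>
     (\<forall>x. (\<forall>n. x n \<in> topspace X) \<longrightarrow>
        (\<exists>A l. AP_set A \<and> subseq_converges_to X x A l))"

definition Hindman_space :: "'a topology \<Rightarrow> bool" where
  "Hindman_space X \<longleftrightarrow> Hausdorff_space X \<and>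
     (\<forall>x. (\<forall>n. x n \<in> topspace X) \<longrightarrow>
        (\<exists>B l. infinite B \<and> IP_converges_to X x B l))"

end

theory Submission
  imports Defs
begin

text \<open>
  Call \<open>A\<close> thin if, for every \<open>d > 0\<close>, only finitely many \<open>x \<in> A\<close> have \<open>x + d \<in> A\<close>; a thin set
  contains no \<open>FS B\<close> with \<open>B\<close> infinite. Under CH there is an almost disjoint family of infinite thin
  sets such that every finite-to-one map on an AP-set sends some smaller AP-set into a member of the
  family: enumerate all such maps in a well-order with countable initial segments. If no member \<open>G\<close>
  chosen so far works for the current map \<open>f\<close> on \<open>C\<close>, then no \<open>f\<close>-preimage of such a \<open>G\<close> in \<open>C\<close> is an
  AP-set, and since the sets that are not AP-sets form an ideal (van der Waerden), one can assemble
  an AP-set from longer and longer finite progressions that avoid more and more of these preimages,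
  while colouring by residues of \<open>f\<close> keeps the image thin. Its image is the new member.

  The space is the one-point compactification of the Mrowka space of the family. A sequence is
  constant or finite-to-one on an AP-set. In the latter case it converges to infinity on an AP-set if
  it avoids \<open>\<omega>\<close> there, and to a member of the family otherwise. The sequence of all isolated points
  has no IP-convergent subsequence: members of the family contain no \<open>FS B\<close>, and the limit is not
  infinity since every infinite \<open>B\<close> meets some member in an infinite set (apply the property of the
  family to the enumeration of \<open>B\<close>).
\<close>

section \<open>Van der Waerden's theorem\<close>

text \<open>The monochromatic progression starts at \<open>a + d\<close>, which leaves \<open>a\<close> as the focus.\<close>

definition vdW_number :: "nat \<Rightarrow> nat set \<Rightarrow> nat \<Rightarrow> bool" where
  "vdW_number k S N \<longleftrightarrow> (\<forall>c. range c \<subseteq> S \<longrightarrow>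
     (\<exists>a d. d > 0 \<and> a + k * d < N \<and> (\<forall>i\<in>{1..k}. c (a + i * d) = (c (a + d) :: nat))))"

text \<open>The progression has \<open>k + 1\<close> terms and starts at \<open>a\<close> itself;
  finding one is the passage from \<open>k\<close> to \<open>Suc k\<close>.\<close>

definition mono_AP :: "(nat \<Rightarrow> nat) \<Rightarrow> nat \<Rightarrow> nat \<Rightarrow> bool" where
  "mono_AP c k N \<longleftrightarrow> (\<exists>a d. d > 0 \<and> a + k * d < N \<and> (\<forall>i\<le>k. c (a + i * d) = c a))"

text \<open>\<open>D\<close> is the set of differences of progressions (rays) of length
  \<open>k\<close> in distinct colours. Continued one term downwards, each of them reaches the focus
  \<open>a\<close>.\<close>

definition colour_focused :: "(nat \<Rightarrow> nat) \<Rightarrow> nat \<Rightarrow> nat \<Rightarrow> nat \<Rightarrow> nat set \<Rightarrow> bool" where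
  "colour_focused c k N a D \<longleftrightarrow> finite D \<and> a < N \<and> inj_on (\<lambda>d. c (a + d)) D \<and>
     (\<forall>d\<in>D. d > 0 \<and> a + k * d < N \<and> (\<forall>i\<in>{1..k}. c (a + i * d) = c (a + d)))"

text \<open>Induction on the number \<open>s\<close> of rays. Colour blocks of length
  \<open>N\<close> by their patterns; the hypothesis for \<open>k\<close> gives \<open>k\<close>
  equal blocks in progression. Rays found inside one block are tilted to run across all of them, and
  the copies of their focus form one more ray.\<close>

lemma colour_focusing:
  assumes k: "k > 0" and vdW: "\<And>S. finite S \<Longrightarrow> \<exists>N. vdW_number k S N" and S: "finite S"
  shows "\<exists>N. \<forall>c. range c \<subseteq> S \<longrightarrow> mono_AP c k N \<or> (\<exists>a D. colour_focused c k N a D \<and> card D = s)"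
proof (induction s)
  case 0
  have "colour_focused c k 1 0 {}" for c
    by (simp add: colour_focused_def)
  then show ?case by (metis card.empty)
next
  case (Suc s)
  then obtain N where N: "\<And>c. range c \<subseteq> S \<Longrightarrow> mono_AP c k N \<or> (\<exists>a D. colour_focused c k N a D \<and> card D = s)"
    by blast
  \<comment> \<open>Codes of the possible patterns of a block, so that blocks are again coloured by
    a finite set of natural numbers.\<close>
  define S' where "S' = list_encode ` {xs. set xs \<subseteq> S \<and> length xs = N}"
  have "finite S'"
    unfolding S'_def using S finite_lists_length_eq by blast
  then obtain M where M: "vdW_number k S' M"
    using vdW by blast
  have "mono_AP c k (M * N) \<or> (\<exists>a D. colour_focused c k (M * N) a D \<and> card D = Suc s)"
    if c: "range c \<subseteq> S" for c
  proof -
    define c' where "c' n = list_encode (map (\<lambda>i. c (n * N + i)) [0..<N])" for n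
    have "range c' \<subseteq> S'"
      using c unfolding S'_def c'_def by fastforce
    with M obtain a d where d: "d > 0" "a + k * d < M" and
      same: "\<And>i. i \<in> {1..k} \<Longrightarrow> c' (a + i * d) = c' (a + d)"
      unfolding vdW_number_def by metis
    have block: "c ((a + i * d) * N + j) = c ((a + d) * N + j)" if "i \<in> {1..k}" "j < N" for i j
      using same[OF that(1)] that(2) by (auto simp: c'_def list_encode_eq map_eq_conv)
    \<comment> \<open>The colouring seen inside block \<open>a + d\<close>, the first of the
      \<open>k\<close> equal blocks. Block \<open>a\<close> precedes them and may have another
      pattern.\<close>
    define b where "b n = c ((a + d) * N + n)" for n
    have bound: "(a + i * d) * N + j < M * N" if "i \<le> k" "j < N" for i j
    proof -
      have "i * d \<le> k * d" using that(1) by (rule mult_le_mono1)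
      then have "a + i * d + 1 \<le> M" using d(2) by linarith
      then have "(a + i * d + 1) * N \<le> M * N"
        using mult_le_mono1 by blast
      then show ?thesis using that(2) by simp
    qed
    have "range b \<subseteq> S" using c by (auto simp: b_def)
    then consider "mono_AP b k N" | a' D where "colour_focused b k N a' D" "card D = s"
      using N by blast
    then show ?thesis
    proof cases
      case 1
      then obtain a' e where e: "e > 0" "a' + k * e < N" "\<And>i. i \<le> k \<Longrightarrow> b (a' + i * e) = b a'"
        unfolding mono_AP_def by blast
      have "mono_AP c k (M * N)"
        unfolding mono_AP_def
        by (rule exI[of _ "(a + d) * N + a'"], rule exI[of _ e])
           (use e bound[of 1 "a' + k * e"] k in \<open>auto simp: b_def add.assoc\<close>)
      then show ?thesis ..
    next
      case 2
      then have D: "finite D" "a' < N" "inj_on (\<lambda>e. b (a' + e)) D"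
        and ray: "\<And>e. e \<in> D \<Longrightarrow> e > 0" "\<And>e. e \<in> D \<Longrightarrow> a' + k * e < N"
           "\<And>e i. e \<in> D \<Longrightarrow> i \<in> {1..k} \<Longrightarrow> b (a' + i * e) = b (a' + e)"
        unfolding colour_focused_def by auto
      have inside: "a' + i * e < N" if "e \<in> D" "i \<le> k" for e i
        using ray(2)[OF that(1)] that(2) by (meson add_left_mono le_less_trans mult_le_mono1)
      show ?thesis
      proof (cases "\<exists>e\<in>D. b (a' + e) = b a'")
        \<comment> \<open>A ray in the colour of its focus is prolonged by the focus to
          \<open>k + 1\<close> terms.\<close>
        case True
        then obtain e where e: "e \<in> D" "b (a' + e) = b a'" by blast
        have "b (a' + i * e) = b a'" if "i \<le> k" for i
          using ray(3)[OF e(1), of i] e(2) that by (cases "i = 0") auto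
        then have "mono_AP c k (M * N)"
          unfolding mono_AP_def
          by (intro exI[of _ "(a + d) * N + a'"] exI[of _ e])
             (use e ray bound[of 1 "a' + k * e"] k in \<open>auto simp: b_def add.assoc\<close>)
        then show ?thesis ..
      next
        case False
        \<comment> \<open>the focus moves back to block \<open>a\<close>, and the old focus becomes a ray of a new colour\<close>
        define D' where "D' = (\<lambda>e. d * N + e) ` insert 0 D"
        have shift: "c (a * N + a' + i * (d * N + e)) = b (a' + i * e)"
          if "e \<in> insert 0 D" "i \<in> {1..k}" for e i
        proof -
          have eq: "a * N + a' + i * (d * N + e) = (a + i * d) * N + (a' + i * e)"
            by (simp add: algebra_simps)
          have "a' + i * e < N"
            using that inside D(2) by (cases "e = 0") auto
          then show ?thesis unfolding eq b_def by (rule block[OF that(2)])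
        qed
        have shift1: "c (a * N + a' + (d * N + e)) = b (a' + e)" if "e \<in> insert 0 D" for e
          using shift[OF that, of 1] k by simp
        have "0 \<notin> D" using ray(1) by blast
        have "N > 0" using D(2) by simp
        have "colour_focused c k (M * N) (a * N + a') D'"
          unfolding colour_focused_def
        proof (intro conjI ballI)
          show "finite D'" using D by (simp add: D'_def)
          show "a * N + a' < M * N" using bound[of 0 a'] D by simp
          have "inj_on (\<lambda>e. b (a' + e)) (insert 0 D)"
            using False D(3) by (auto simp: inj_on_def)
          then show "inj_on (\<lambda>e. c (a * N + a' + e)) D'"
            unfolding D'_def using inj_on_cong[of "insert 0 D", OF shift1] by (intro inj_on_imageI) (simp only: o_def)
        next
          fix x assume "x \<in> D'"
          then obtain e where e: "e \<in> insert 0 D" "x = d * N + e" unfolding D'_def by blast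
          show "x > 0" using \<open>N > 0\<close> d e by simp
          have "a' + k * e < N" using e ray(2) D by auto
          from bound[OF order_refl this] show "a * N + a' + k * x < M * N"
            by (simp add: e algebra_simps)
          show "c (a * N + a' + i * x) = c (a * N + a' + x)" if i: "i \<in> {1..k}" for i
          proof -
            have "b (a' + i * e) = b (a' + e)"
              using e(1) ray(3) i by (cases "e = 0") auto
            then show ?thesis using shift[OF e(1) i] shift1[OF e(1)] e(2) by simp
          qed
        qed
        moreover have "card D' = Suc s"
          unfolding D'_def using 2(2) D(1) \<open>0 \<notin> D\<close>
          by (subst card_image) (auto simp: inj_on_def)
        ultimately show ?thesis by blast
      qed
    qed
  qed
  then show ?case by blast
qed

text \<open>Induction on the length. If one more ray than there are colours is demanded, the
  pigeonhole principle leaves only the progression of \<open>k + 1\<close> terms in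
  \<open>colour_focusing\<close>.\<close>

lemma van_der_Waerden:
  assumes "finite S"
  shows "\<exists>N. vdW_number k S N"
  using assms
proof (induction k arbitrary: S)
  case 0
  have "vdW_number 0 S 1" unfolding vdW_number_def by auto
  then show ?case ..
next
  case (Suc k)
  show ?case
  proof (cases "k = 0")
    \<comment> \<open>\<open>colour_focusing\<close> assumes \<open>k > 0\<close>, so a single term
      is treated directly.\<close>
    case True
    have "vdW_number 1 S 2" unfolding vdW_number_def
      by (intro allI impI, rule exI[of _ 0], rule exI[of _ 1]) auto
    then show ?thesis using True by auto
  next
    case False
    then obtain N where N: "\<And>c. range c \<subseteq> S \<Longrightarrow>
        mono_AP c k N \<or> (\<exists>a D. colour_focused c k N a D \<and> card D = Suc (card S))"
      using colour_focusing[where s = "Suc (card S)", OF _ Suc.IH Suc.prems] by blast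
    have "mono_AP c k N" if "range c \<subseteq> S" for c
    proof -
      have False if foc: "colour_focused c k N a D" "card D = Suc (card S)" for a D
      proof -
        have "inj_on (\<lambda>d. c (a + d)) D" "(\<lambda>d. c (a + d)) ` D \<subseteq> S"
          using foc \<open>range c \<subseteq> S\<close> by (auto simp: colour_focused_def)
        then have "card D \<le> card S"
          using Suc.prems card_inj_on_le by blast
        with foc show False by simp
      qed
      with N[OF that] show ?thesis by blast
    qed
    note mono = this
    have "vdW_number (Suc k) S (2 * N)"
      unfolding vdW_number_def
    proof (intro allI impI)
      fix c :: "nat \<Rightarrow> nat" assume "range c \<subseteq> S"
      \<comment> \<open>The shift by \<open>N\<close> leaves room for the required point
        \<open>a + N - d\<close> before the progression. The subtraction is not truncated, as
        \<open>d \<le> k * d < N\<close>.\<close>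
      then have "range (\<lambda>n. c (n + N)) \<subseteq> S" by auto
      from mono[OF this] obtain a d where d: "d > 0" "a + k * d < N"
        "\<And>i. i \<le> k \<Longrightarrow> c (a + i * d + N) = c (a + N)" unfolding mono_AP_def by auto
      have "d \<le> k * d" using False by simp
      then have "d \<le> N" using d(2) by linarith
      have eq: "a + N - d + Suc i * d = a + i * d + N" for i
        using \<open>d \<le> N\<close> by simp
      show "\<exists>a d. d > 0 \<and> a + Suc k * d < 2 * N \<and> (\<forall>i\<in>{1..Suc k}. c (a + i * d) = c (a + d))"
      proof (intro exI conjI ballI)
        show "d > 0" by fact
        show "a + N - d + Suc k * d < 2 * N" unfolding eq using d by simp
        fix i assume "i \<in> {1..Suc k}"
        then obtain j where "i = Suc j" "j \<le> k" by (cases i) auto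
        then show "c (a + N - d + i * d) = c (a + N - d + d)"
          using eq[of j] eq[of 0] d(3)[of j] by (metis mult_1 mult_0 add_0_right One_nat_def)
      qed
    qed
    then show ?thesis ..
  qed
qed

section \<open>AP-sets\<close>

definition has_AP :: "nat \<Rightarrow> nat set \<Rightarrow> bool" where
  "has_AP k A \<longleftrightarrow> (\<exists>a d. d > 0 \<and> (\<forall>i<k. a + i * d \<in> A))"

lemma AP_set_iff_has_AP: "AP_set A \<longleftrightarrow> (\<forall>k. has_AP k A)"
  by (simp add: AP_set_def has_AP_def)

lemma has_AP_mono: "has_AP k A \<Longrightarrow> A \<subseteq> B \<Longrightarrow> l \<le> k \<Longrightarrow> has_AP l B"
  unfolding has_AP_def by (meson less_le_trans subsetD)

lemma AP_set_mono: "AP_set A \<Longrightarrow> A \<subseteq> B \<Longrightarrow> AP_set B"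
  unfolding AP_set_iff_has_AP by (meson has_AP_mono order_refl)

lemma AP_set_UNIV: "AP_set UNIV"
  unfolding AP_set_def by (auto intro: exI[of _ 1])

text \<open>Otherwise some length \<open>m\<close> occurs in neither set. Take a progression in the
  union with as many terms as van der Waerden requires and colour its indices by membership in
  \<open>A\<close>: a monochromatic progression of indices yields \<open>m\<close> terms inside
  \<open>A\<close> or inside \<open>B\<close>.\<close>

lemma AP_set_Un:
  assumes "AP_set (A \<union> B)"
  shows "AP_set A \<or> AP_set B"
proof (rule ccontr)
  assume "\<not> ?thesis"
  then obtain k l where "\<not> has_AP k A" "\<not> has_AP l B"
    by (auto simp: AP_set_iff_has_AP)
  then have no: "\<not> has_AP (max k l) A" "\<not> has_AP (max k l) B"
    by (meson has_AP_mono order_refl max.cobounded1 max.cobounded2)+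
  define m where "m = max k l"
  obtain N where N: "vdW_number m {0, 1} N"
    using van_der_Waerden[of "{0, 1}" m] by auto
  obtain a d where d: "d > 0" "\<And>i. i < N \<Longrightarrow> a + i * d \<in> A \<union> B"
    using assms unfolding AP_set_def by meson
  define c :: "nat \<Rightarrow> nat" where "c i = of_bool (a + i * d \<in> A)" for i
  have "range c \<subseteq> {0, 1}" by (auto simp: c_def)
  with N obtain b e where e: "e > 0" "b + m * e < N" "\<And>i. i \<in> {1..m} \<Longrightarrow> c (b + i * e) = c (b + e)"
    unfolding vdW_number_def by metis
  have eq: "a + (b + e) * d + i * (e * d) = a + (b + Suc i * e) * d" for i
    by (simp add: algebra_simps)
  have mem: "a + (b + Suc i * e) * d \<in> A \<union> B"
    and same: "a + (b + Suc i * e) * d \<in> A \<longleftrightarrow> a + (b + e) * d \<in> A" if "i < m" for i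
  proof -
    have "Suc i * e \<le> m * e" using that by (meson Suc_leI mult_le_mono1)
    then show "a + (b + Suc i * e) * d \<in> A \<union> B" by (intro d(2)) (use e(2) in linarith)
    have "c (b + Suc i * e) = c (b + e)" using that by (intro e(3)) auto
    then show "a + (b + Suc i * e) * d \<in> A \<longleftrightarrow> a + (b + e) * d \<in> A"
      by (auto simp: c_def of_bool_def split: if_splits)
  qed
  have "e * d > 0" using e(1) d(1) by simp
  then have "has_AP m A \<or> has_AP m B"
    unfolding has_AP_def using eq mem same by (metis Un_iff)
  then show False using no m_def by blast
qed

lemma AP_set_imp_infinite:
  assumes "AP_set A"
  shows "infinite A"
proof
  assume "finite A"
  obtain a d where d: "d > 0" "\<And>i. i < Suc (card A) \<Longrightarrow> a + i * d \<in> A"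
    using assms unfolding AP_set_def by meson
  then have "(\<lambda>i. a + i * d) ` {..<Suc (card A)} \<subseteq> A" by auto
  moreover have "inj_on (\<lambda>i. a + i * d) {..<Suc (card A)}"
    using d(1) by (auto simp: inj_on_def)
  ultimately have "card {..<Suc (card A)} \<le> card A"
    using \<open>finite A\<close> by (intro card_inj_on_le)
  then show False by simp
qed

lemma AP_set_UN:
  assumes "finite I" "AP_set (\<Union>i\<in>I. A i)"
  shows "\<exists>i\<in>I. AP_set (A i)"
  using assms
proof (induction I rule: finite_induct)
  case empty
  then show ?case using AP_set_imp_infinite by fastforce
next
  case (insert i I)
  then show ?case using AP_set_Un[of "A i" "\<Union>i\<in>I. A i"] by auto
qed

lemma AP_set_Diff:
  assumes "AP_set A" "\<not> AP_set (A \<inter> B)"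
  shows "AP_set (A - B)"
  using AP_set_Un[of "A - B" "A \<inter> B"] assms by (simp add: Un_Diff_Int)

text \<open>The \<open>k\<close>-th piece is a progression of length \<open>k\<close> cut out of the
  AP-set that \<open>step\<close> offers for the union of the earlier pieces; by \<open>mono\<close>
  it keeps \<open>Q\<close>. The pieces together contain progressions of every length.\<close>

lemma AP_set_fusion:
  fixes Q :: "nat \<Rightarrow> nat set \<Rightarrow> nat set \<Rightarrow> bool"
  assumes step: "\<And>k H. finite H \<Longrightarrow> \<exists>E\<subseteq>C. AP_set E \<and> Q k H E"
    and mono: "\<And>k H E E'. Q k H E \<Longrightarrow> E' \<subseteq> E \<Longrightarrow> Q k H E'"
  shows "\<exists>P. (\<forall>k. finite (P k) \<and> P k \<subseteq> C \<and> Q k (\<Union>i<k. P i) (P k)) \<and> AP_set (\<Union>k. P k)"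
proof -
  define R where "R P k E \<longleftrightarrow> finite E \<and> E \<subseteq> C \<and> has_AP k E \<and> Q k (\<Union>i<k. P i) E"
    for P :: "nat \<Rightarrow> nat set" and k E
  have "\<exists>P. \<forall>k. R P k (P k)"
  proof (rule dependent_wf_choice[where R = less_than])
    show "wf less_than" by simp
    show "R f x r = R g x r" if "\<And>z. (z, x) \<in> less_than \<Longrightarrow> f z = g z" for f g x r
    proof -
      have "(\<Union>i<x. f i) = (\<Union>i<x. g i)" using that by auto
      then show ?thesis by (simp add: R_def)
    qed
    fix k P assume "\<And>y. (y, k) \<in> less_than \<Longrightarrow> R P y (P y)"
    then have "finite (\<Union>i<k. P i)"
      by (auto simp: R_def)
    then obtain E where E: "E \<subseteq> C" "AP_set E" "Q k (\<Union>i<k. P i) E"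
      using step by meson
    obtain a d where d: "d > 0" "\<And>i. i < k \<Longrightarrow> a + i * d \<in> E"
      using E(2) unfolding AP_set_def by meson
    have sub: "(\<lambda>i. a + i * d) ` {..<k} \<subseteq> E" using d by auto
    have "has_AP k ((\<lambda>i. a + i * d) ` {..<k})"
      unfolding has_AP_def using d(1) by blast
    then have "R P k ((\<lambda>i. a + i * d) ` {..<k})"
      unfolding R_def using sub E(1) mono[OF E(3) sub] by auto
    then show "\<exists>r. R P k r" ..
  qed
  then obtain P where P: "\<And>k. R P k (P k)" by blast
  have "AP_set (\<Union>k. P k)"
    unfolding AP_set_iff_has_AP using P has_AP_mono R_def by (meson UNIV_I UN_upper order_refl)
  then show ?thesis using P R_def by blast
qed

section \<open>Finite-to-one maps on AP-sets\<close>

definition finite_fibres_on :: "('a \<Rightarrow> 'b) \<Rightarrow> 'a set \<Rightarrow> bool" where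
  "finite_fibres_on f C \<longleftrightarrow> (\<forall>y. finite {x \<in> C. f x = y})"

lemma finite_fibres_on_subset:
  assumes "finite_fibres_on f C" "D \<subseteq> C"
  shows "finite_fibres_on f D"
  unfolding finite_fibres_on_def
proof
  fix y
  have "finite {x \<in> C. f x = y}" using assms(1) by (simp add: finite_fibres_on_def)
  then show "finite {x \<in> D. f x = y}" by (rule rev_finite_subset) (use assms(2) in auto)
qed

lemma finite_fibres_on_vimage:
  assumes "finite_fibres_on f C" "finite Y"
  shows "finite {x \<in> C. f x \<in> Y}"
proof -
  have "{x \<in> C. f x \<in> Y} = (\<Union>y\<in>Y. {x \<in> C. f x = y})" by auto
  then show ?thesis using assms by (simp add: finite_fibres_on_def)
qed

lemma finite_fibres_on_infinite_image:
  assumes "finite_fibres_on f C" "infinite C"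
  shows "infinite (f ` C)"
proof
  assume "finite (f ` C)"
  then have "finite {x \<in> C. f x \<in> f ` C}" using assms(1) finite_fibres_on_vimage by blast
  moreover have "{x \<in> C. f x \<in> f ` C} = C" by blast
  ultimately show False using assms(2) by simp
qed

text \<open>If no fibre in \<open>C\<close> is an AP-set, neither is the preimage of a finite set,
  so fusion can keep the images of the pieces disjoint. Every value is then taken on a single finite
  piece.\<close>

lemma AP_set_canonical:
  fixes f :: "nat \<Rightarrow> 'b"
  assumes "AP_set C"
  obtains D where "D \<subseteq> C" "AP_set D" "(\<exists>y. \<forall>n\<in>D. f n = y) \<or> finite_fibres_on f D"
proof (cases "\<exists>y. AP_set {n \<in> C. f n = y}")
  case True
  then show ?thesis using that by (metis (mono_tags, lifting) mem_Collect_eq subsetI)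
next
  case False
  define Q where "Q k H E \<longleftrightarrow> f ` E \<inter> f ` H = {}" for k :: nat and H E
  have step: "\<exists>E\<subseteq>C. AP_set E \<and> Q k H E" if "finite H" for k H
  proof -
    have "C \<inter> {n. f n \<in> f ` H} = (\<Union>y\<in>f ` H. {n \<in> C. f n = y})" by auto
    then have "\<not> AP_set (C \<inter> {n. f n \<in> f ` H})"
      using AP_set_UN[of "f ` H" "\<lambda>y. {n \<in> C. f n = y}"] False that by auto
    then have "AP_set (C - {n. f n \<in> f ` H})" using assms AP_set_Diff by blast
    then show ?thesis by (intro exI[of _ "C - {n. f n \<in> f ` H}"]) (auto simp: Q_def)
  qed
  have mono: "Q k H E'" if "Q k H E" "E' \<subseteq> E" for k H E E'
    using that unfolding Q_def by blast
  have "\<exists>P. (\<forall>k. finite (P k) \<and> P k \<subseteq> C \<and> Q k (\<Union>i<k. P i) (P k)) \<and> AP_set (\<Union>k. P k)"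
    by (rule AP_set_fusion, erule step, erule (1) mono)
  then obtain P where "\<forall>k. finite (P k) \<and> P k \<subseteq> C \<and> Q k (\<Union>i<k. P i) (P k)"
    and APP: "AP_set (\<Union>k. P k)" by blast
  then have P: "finite (P k)" "P k \<subseteq> C" "f ` P k \<inter> f ` (\<Union>i<k. P i) = {}" for k
    by (simp_all add: Q_def)
  have "f m \<noteq> f n" if "m \<in> P j" "n \<in> P k" "j < k" for j k m n
    using P(3)[of k] that by blast
  then have same: "j = k" if "m \<in> P j" "n \<in> P k" "f m = f n" for j k m n
    using that by (metis linorder_neqE_nat)
  have "finite {n \<in> (\<Union>k. P k). f n = y}" for y
  proof (cases "\<exists>m j. m \<in> P j \<and> f m = y")
    case True
    then obtain m j where "m \<in> P j" "f m = y" by blast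
    then have "{n \<in> (\<Union>k. P k). f n = y} \<subseteq> P j" using same by blast
    then show ?thesis using P(1) finite_subset by blast
  next
    case False
    then have "{n \<in> (\<Union>k. P k). f n = y} = {}" by blast
    then show ?thesis by (metis finite.emptyI)
  qed
  then show ?thesis using that[of "\<Union>k. P k"] P(2) APP by (auto simp: finite_fibres_on_def)
qed

section \<open>An almost disjoint family\<close>

definition thin :: "nat set \<Rightarrow> bool" where
  "thin A \<longleftrightarrow> (\<forall>d>0. finite {x \<in> A. x + d \<in> A})"

lemma thin_empty: "thin {}"
  by (simp add: thin_def)

lemma subset_FS: "B \<subseteq> FS B"
proof
  fix b assume "b \<in> B"
  then have "\<Sum>{b} \<in> FS B" unfolding FS_def by blast
  then show "b \<in> FS B" by simp
qed

text \<open>For a fixed positive \<open>b\<close> in \<open>B\<close>, every other \<open>x\<close>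
  in \<open>B\<close> has both \<open>x\<close> and \<open>x + b\<close> in \<open>FS B\<close>, so
  the difference \<open>b\<close> occurs infinitely often.\<close>

lemma not_FS_subset_thin:
  assumes "thin A" "infinite B"
  shows "\<not> FS B \<subseteq> A"
proof
  assume FS: "FS B \<subseteq> A"
  have "infinite (B - {0})" using assms(2) by simp
  then obtain b where b: "b \<in> B" "b > 0" by (metis DiffE all_not_in_conv finite.emptyI gr0I singletonI)
  have "B - {b} \<subseteq> {x \<in> A. x + b \<in> A}"
  proof
    fix x assume x: "x \<in> B - {b}"
    then have "\<Sum>{x, b} \<in> FS B" using b unfolding FS_def by blast
    then have "x + b \<in> A" using x FS by auto
    then show "x \<in> {x \<in> A. x + b \<in> A}" using x FS subset_FS by auto
  qed
  then have "finite (B - {b})" using assms(1) b(2) finite_subset unfolding thin_def by blast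
  then show False using assms(2) by simp
qed

text \<open>Fusion in which the values of \<open>f\<close> on piece \<open>k\<close> avoid
  \<open>G i\<close> for \<open>i < k\<close>, exceed all earlier values by more than
  \<open>k\<close>, and lie more than \<open>k\<close> apart from each other. Hence
  \<open>G i\<close> is met only by the pieces up to \<open>i\<close>.\<close>

lemma AP_set_diagonal:
  fixes f :: "nat \<Rightarrow> nat" and G :: "nat \<Rightarrow> nat set"
  assumes C: "AP_set C" and f: "finite_fibres_on f C"
    and G: "\<And>i. \<not> AP_set {n \<in> C. f n \<in> G i}"
  shows "\<exists>D\<subseteq>C. AP_set D \<and> thin (f ` D) \<and> (\<forall>i. finite (f ` D \<inter> G i))"
proof -
  define Q where "Q k H E \<longleftrightarrow> (\<forall>e\<in>E. (\<forall>i<k. f e \<notin> G i) \<and> (\<forall>h\<in>H. f h + k < f e) \<and>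
      (\<forall>e'\<in>E. f e < f e' \<longrightarrow> f e + k < f e'))" for k H E
  have step: "\<exists>E\<subseteq>C. AP_set E \<and> Q k H E" if "finite H" for k H
  proof -
    have "C \<inter> (\<Union>i<k. {n. f n \<in> G i}) = (\<Union>i<k. {n \<in> C. f n \<in> G i})" by blast
    then have "\<not> AP_set (C \<inter> (\<Union>i<k. {n. f n \<in> G i}))"
      using AP_set_UN[of "{..<k}" "\<lambda>i. {n \<in> C. f n \<in> G i}"] G by fastforce
    then have "AP_set (C - (\<Union>i<k. {n. f n \<in> G i}))" (is "AP_set ?C1")
      using C AP_set_Diff by blast
    moreover have "finite (\<Union>h\<in>H. {..f h + k})" using that by blast
    then have "finite {n \<in> C. f n \<in> (\<Union>h\<in>H. {..f h + k})}"
      using f finite_fibres_on_vimage by blast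
    then have "finite (?C1 \<inter> {n. f n \<in> (\<Union>h\<in>H. {..f h + k})})"
      by (rule rev_finite_subset) auto
    ultimately have C2: "AP_set (?C1 - {n. f n \<in> (\<Union>h\<in>H. {..f h + k})})" (is "AP_set ?C2")
      using AP_set_Diff AP_set_imp_infinite by blast
    \<comment> \<open>One residue class modulo \<open>k + 1\<close> still gives an AP-set, and
      distinct congruent values differ by at least \<open>k + 1\<close>.\<close>
    have "(\<Union>r\<in>{..k}. {n \<in> ?C2. f n mod Suc k = r}) = ?C2"
      by (auto simp: less_Suc_eq_le[symmetric])
    then obtain r where r: "AP_set {n \<in> ?C2. f n mod Suc k = r}" (is "AP_set ?E")
      using AP_set_UN[of "{..k}" "\<lambda>r. {n \<in> ?C2. f n mod Suc k = r}"] C2 by auto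
    have gap: "x + k < y" if "x < y" "x mod Suc k = y mod Suc k" for x y :: nat
    proof -
      have "Suc k dvd y - x" using that by (metis mod_eq_dvd_iff_nat less_imp_le)
      then have "Suc k \<le> y - x" using that(1) by (intro dvd_imp_le) auto
      then show ?thesis by simp
    qed
    have "Q k H ?E"
      unfolding Q_def using gap by (auto simp: not_le)
    then show ?thesis using r by (intro exI[of _ ?E]) auto
  qed
  have mono: "Q k H E'" if "Q k H E" "E' \<subseteq> E" for k H E E'
    using that unfolding Q_def by (meson subsetD)
  have "\<exists>P. (\<forall>k. finite (P k) \<and> P k \<subseteq> C \<and> Q k (\<Union>i<k. P i) (P k)) \<and> AP_set (\<Union>k. P k)"
    by (rule AP_set_fusion, erule step, erule (1) mono)
  then obtain P where P: "\<And>k. finite (P k)" "\<And>k. P k \<subseteq> C"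
    "\<And>k. Q k (\<Union>i<k. P i) (P k)" "AP_set (\<Union>k. P k)"
    by auto
  \<comment> \<open>If two values differ by \<open>d\<close>, the larger one cannot come from an
    earlier piece than the smaller, and its piece has index below \<open>d\<close>. So the smaller
    value comes from one of the first \<open>d\<close> finite pieces.\<close>
  have "finite {x \<in> f ` (\<Union>k. P k). x + d \<in> f ` (\<Union>k. P k)}" if "d > 0" for d
  proof (rule finite_subset)
    show "finite (f ` (\<Union>k<d. P k))" using P(1) by blast
    show "{x \<in> f ` (\<Union>k. P k). x + d \<in> f ` (\<Union>k. P k)} \<subseteq> f ` (\<Union>k<d. P k)"
    proof clarsimp
      fix m n j k assume *: "m \<in> P j" "n \<in> P k" "f m + d = f n"
      have "f m + k < f n" if "j \<le> k"
      proof (cases "j = k")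
        case True
        then show ?thesis using P(3)[of k] * \<open>d > 0\<close> unfolding Q_def by auto
      next
        case False
        then have "m \<in> (\<Union>i<k. P i)" using that * by auto
        then show ?thesis using P(3)[of k] * unfolding Q_def by blast
      qed
      moreover have False if "k < j"
      proof -
        have "n \<in> (\<Union>i<j. P i)" using that * by auto
        then have "f n < f m" using P(3)[of j] * unfolding Q_def by fastforce
        then show False using * by simp
      qed
      ultimately have "j < d" using * by (metis add_less_cancel_left leI le_less_trans)
      then show "f m \<in> f ` (\<Union>k<d. P k)" using * by auto
    qed
  qed
  then have "thin (f ` (\<Union>k. P k))" by (simp add: thin_def)
  moreover have "finite (f ` (\<Union>k. P k) \<inter> G i)" for i
  proof (rule finite_subset)
    show "finite (f ` (\<Union>k\<le>i. P k))" using P(1) by blast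
    have "k \<le> i" if "n \<in> P k" "f n \<in> G i" for n k
      using P(3)[of k] that unfolding Q_def by (meson not_le)
    then show "f ` (\<Union>k. P k) \<inter> G i \<subseteq> f ` (\<Union>k\<le>i. P k)" by blast
  qed
  ultimately show ?thesis using P(2,4) by (intro exI[of _ "\<Union>k. P k"]) auto
qed

section \<open>Transfinite recursion under the Continuum Hypothesis\<close>

lemma CH_wellorder:
  assumes "CH"
  shows "\<exists>r :: real rel. wf r \<and> (\<forall>x y. x \<noteq> y \<longrightarrow> (x, y) \<in> r \<or> (y, x) \<in> r) \<and>
    (\<forall>x. countable {y. (y, x) \<in> r})"
proof -
  \<comment> \<open>A well-order of the reals of least possible type: its proper initial segments
    have smaller cardinality, hence are countable by \<open>CH\<close>.\<close>
  define r where "r = card_of (UNIV :: real set)"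
  have W: "well_order_on UNIV r" and F: "Field r = UNIV"
    by (simp_all add: r_def card_of_well_order_on Field_card_of)
  have wf: "wf (r - Id)" using W by (simp add: well_order_on_def)
  have tot: "(x, y) \<in> r - Id \<or> (y, x) \<in> r - Id" if "x \<noteq> y" for x y
    using W that by (auto simp: well_order_on_def linear_order_on_def total_on_def)
  have "countable {y. (y, x) \<in> r - Id}" for x
  proof -
    have eq: "{y. (y, x) \<in> r - Id} = underS r x" by (auto simp: underS_def)
    have "Card_order r" unfolding r_def by (rule card_of_Card_order)
    then have "(card_of (underS r x), r) \<in> ordLess"
      by (rule card_of_underS) (simp add: F)
    then have "\<not> underS r x \<approx> (UNIV :: real set)"
      unfolding eqpoll_iff_card_of_ordIso r_def by (rule not_ordLess_ordIso)
    then show ?thesis using assms unfolding CH_def eq by blast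
  qed
  with wf tot show ?thesis by (intro exI[of _ "r - Id"]) simp
qed

text \<open>A partial map on the naturals is coded by its graph, a set of naturals, and there are as
  many of these as reals. \<open>C t\<close> is the domain read off from the code;
  \<open>f t\<close> is arbitrary outside it, hence agreement only on \<open>D\<close>.\<close>

lemma AP_tasks_enumeration:
  "\<exists>(f :: real \<Rightarrow> nat \<Rightarrow> nat) C. \<forall>g D. \<exists>t. C t = D \<and> (\<forall>n\<in>D. f t n = g n)"
proof -
  obtain e :: "real \<Rightarrow> nat set" where e: "bij e"
    using nat_sets_eqpoll_reals eqpoll_sym unfolding eqpoll_def by blast
  define C where "C t = {n. \<exists>m. prod_encode (n, m) \<in> e t}" for t
  define f where "f t n = (SOME m. prod_encode (n, m) \<in> e t)" for t n
  have "\<exists>t. C t = D \<and> (\<forall>n\<in>D. f t n = g n)" for g D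
  proof -
    obtain t where t: "e t = (\<lambda>n. prod_encode (n, g n)) ` D"
      using e by (metis bij_pointE)
    have iff: "prod_encode (n, m) \<in> e t \<longleftrightarrow> n \<in> D \<and> m = g n" for n m
      unfolding t by (auto simp: prod_encode_eq)
    show ?thesis
      by (rule exI[of _ t]) (auto simp: C_def f_def iff)
  qed
  then show ?thesis by (intro exI[of _ f] exI[of _ C]) simp
qed

lemma CH_almost_disjoint_family:
  assumes "CH"
  obtains \<A> where "\<forall>A\<in>\<A>. infinite A \<and> thin A"
    "\<forall>A\<in>\<A>. \<forall>B\<in>\<A>. A \<noteq> B \<longrightarrow> finite (A \<inter> B)"
    "\<forall>f C. AP_set C \<and> finite_fibres_on f C \<longrightarrow> (\<exists>A\<in>\<A>. \<exists>D\<subseteq>C. AP_set D \<and> f ` D \<subseteq> A)"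
proof -
  obtain r :: "real rel" where wf: "wf r"
    and total: "\<And>x y. x \<noteq> y \<Longrightarrow> (x, y) \<in> r \<or> (y, x) \<in> r"
    and count: "\<And>x. countable {y. (y, x) \<in> r}"
    using CH_wellorder[OF assms] by auto
  obtain f :: "real \<Rightarrow> nat \<Rightarrow> nat" and C :: "real \<Rightarrow> nat set"
    where tasks: "\<And>g D. \<exists>t. C t = D \<and> (\<forall>n\<in>D. f t n = g n)"
    using AP_tasks_enumeration by auto
  define solves where "solves t S \<longleftrightarrow> (\<exists>D\<subseteq>C t. AP_set D \<and> f t ` D \<subseteq> S)" for t S
  \<comment> \<open>The alternative \<open>F s = S\<close> lets a stage repeat an earlier
    set.\<close>
  define P where "P F t S \<longleftrightarrow> thin S \<and> (\<forall>s. (s, t) \<in> r \<longrightarrow> F s = S \<or> finite (F s \<inter> S)) \<and>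
      (AP_set (C t) \<and> finite_fibres_on (f t) (C t) \<longrightarrow> solves t S)"
    for F :: "real \<Rightarrow> nat set" and t S
  have "\<exists>F. \<forall>t. P F t (F t)"
  proof (rule dependent_wf_choice[OF wf])
    show "P F t S = P F' t S" if "\<And>z. (z, t) \<in> r \<Longrightarrow> F z = F' z" for F F' t S
      using that by (auto simp: P_def)
    fix t F assume prev: "\<And>s. (s, t) \<in> r \<Longrightarrow> P F s (F s)"
    consider "\<not> (AP_set (C t) \<and> finite_fibres_on (f t) (C t))"
      | s where "(s, t) \<in> r" "solves t (F s)"
      | "AP_set (C t)" "finite_fibres_on (f t) (C t)" "\<And>s. (s, t) \<in> r \<Longrightarrow> \<not> solves t (F s)"
      by blast
    then show "\<exists>S. P F t S"
    proof cases
      case 1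
      \<comment> \<open>The empty set is a placeholder at stages that pose no task.\<close>
      then have "P F t {}" by (auto simp: P_def thin_empty)
      then show ?thesis ..
    next
      case 2
      \<comment> \<open>An earlier set already solves the task and is repeated. The recursion
        condition at the later of \<open>s\<close> and \<open>s'\<close> compares the two
        sets.\<close>
      have "F s' = F s \<or> finite (F s' \<inter> F s)" if "(s', t) \<in> r" for s'
      proof (cases "s' = s")
        case False
        then have "(s', s) \<in> r \<or> (s, s') \<in> r" by (rule total)
        then show ?thesis
          using prev[OF that] prev[OF 2(1)] unfolding P_def by (auto simp: inf_commute)
      qed simp
      then have "P F t (F s)"
        using 2 prev[OF 2(1)] by (simp add: P_def)
      then show ?thesis ..
    next
      case 3
      \<comment> \<open>The countably many earlier sets as a sequence, constantly empty if there are
        none. An AP-set preimage of one of them would itself be a solution of the task, contrary to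
        the case assumption.\<close>
      define G where "G = (if {s. (s, t) \<in> r} = {} then \<lambda>_. {} else F \<circ> from_nat_into {s. (s, t) \<in> r})"
      have G: "\<exists>i. G i = F s" if "(s, t) \<in> r" for s
        using that from_nat_into_surj[OF count[of t], of s] unfolding G_def by fastforce
      have not_AP: "\<not> AP_set {n \<in> C t. f t n \<in> G i}" for i
      proof
        assume AP: "AP_set {n \<in> C t. f t n \<in> G i}"
        then have ne: "{s. (s, t) \<in> r} \<noteq> {}"
          using AP_set_imp_infinite unfolding G_def by fastforce
        then have "(from_nat_into {s. (s, t) \<in> r} i, t) \<in> r"
          using from_nat_into[OF ne, of i] by simp
        then have "\<not> solves t (F (from_nat_into {s. (s, t) \<in> r} i))" by (rule 3(3))
        then have "\<not> solves t (G i)" using ne unfolding G_def by (simp only: if_False o_def simp_thms)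
        moreover have "solves t (G i)"
          unfolding solves_def using AP by (intro exI[of _ "{n \<in> C t. f t n \<in> G i}"]) auto
        ultimately show False ..
      qed
      obtain D where D: "D \<subseteq> C t" "AP_set D" "thin (f t ` D)" "\<And>i. finite (f t ` D \<inter> G i)"
        using AP_set_diagonal[of "C t" "f t" G, OF 3(1,2) not_AP] by auto
      have "P F t (f t ` D)"
        unfolding P_def
      proof (intro conjI allI impI)
        show "F s = f t ` D \<or> finite (F s \<inter> f t ` D)" if "(s, t) \<in> r" for s
          using G[OF that] D(4) by (metis inf_commute)
        show "solves t (f t ` D)" unfolding solves_def using D(1,2) by blast
      qed (fact D(3))
      then show ?thesis ..
    qed
  qed
  then obtain F where F: "\<And>t. P F t (F t)" by blast
  \<comment> \<open>Keeping only the infinite values drops the placeholders. A set that solves a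
    task survives, since it contains a finite-to-one image of an AP-set.\<close>
  show ?thesis
  proof (rule that[of "{F t | t. infinite (F t)}"]; intro ballI allI impI)
    show "infinite A \<and> thin A" if "A \<in> {F t | t. infinite (F t)}" for A
      using that F unfolding P_def by auto
    show "finite (A \<inter> B)"
      if AB: "A \<in> {F t | t. infinite (F t)}" "B \<in> {F t | t. infinite (F t)}" "A \<noteq> B" for A B
    proof -
      obtain s t where st: "A = F s" "B = F t" using AB by blast
      then have "s \<noteq> t" using AB by blast
      then have "(s, t) \<in> r \<or> (t, s) \<in> r" by (rule total)
      then show ?thesis using F[of s] F[of t] AB(3) unfolding st P_def by (auto simp: inf_commute)
    qed
    show "\<exists>A\<in>{F t | t. infinite (F t)}. \<exists>E\<subseteq>D. AP_set E \<and> g ` E \<subseteq> A"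
      if "AP_set D \<and> finite_fibres_on g D" for g D
    proof -
      have g: "AP_set D" "finite_fibres_on g D" using that by auto
      obtain t where t: "C t = D" "\<And>n. n \<in> D \<Longrightarrow> f t n = g n" using tasks by metis
      have "finite_fibres_on (f t) (C t)"
        using g(2) t by (simp add: finite_fibres_on_def cong: conj_cong)
      then have "solves t (F t)" using F[of t] g(1) t(1) unfolding P_def by blast
      then obtain E where E: "E \<subseteq> D" "AP_set E" "f t ` E \<subseteq> F t"
        unfolding solves_def t(1) by blast
      then have gE: "g ` E \<subseteq> F t" using t(2) by force
      moreover have "infinite (g ` E)"
        using E finite_fibres_on_subset[OF g(2)] AP_set_imp_infinite finite_fibres_on_infinite_image by blast
      ultimately have "infinite (F t)" using finite_subset by blast
      then show ?thesis using E gE by blast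
    qed
  qed
qed

section \<open>The one-point compactification of a Mrowka space\<close>

text \<open>The points are the isolated points \<open>p n\<close>, the points of \<open>L\<close>, where \<open>p\<close> converges to \<open>l\<close>
  along \<open>tr l\<close>, and the point \<open>w\<close> at infinity.\<close>

locale mrowka =
  fixes p :: "nat \<Rightarrow> 'a" and L :: "'a set" and tr :: "'a \<Rightarrow> nat set" and w :: 'a
  assumes inj_p: "inj p" and p_notin_L: "\<And>n. p n \<notin> L" and w_notin_L: "w \<notin> L"
    and p_neq_w: "\<And>n. p n \<noteq> w"
    and infinite_tr: "\<And>l. l \<in> L \<Longrightarrow> infinite (tr l)"
    and almost_disjoint: "\<And>l m. l \<in> L \<Longrightarrow> m \<in> L \<Longrightarrow> l \<noteq> m \<Longrightarrow> finite (tr l \<inter> tr m)"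
begin

lemma p_eq_iff [simp]: "p m = p n \<longleftrightarrow> m = n"
  using inj_p by (auto dest: injD)

definition points :: "'a set" where
  "points = range p \<union> L \<union> {w}"

definition opn :: "'a set \<Rightarrow> bool" where
  "opn U \<longleftrightarrow> U \<subseteq> points \<and> (\<forall>l\<in>L \<inter> U. finite {n \<in> tr l. p n \<notin> U}) \<and>
     (w \<in> U \<longrightarrow> (\<exists>K\<subseteq>L. finite K \<and> L - K \<subseteq> U \<and> finite {n. p n \<notin> U \<and> n \<notin> (\<Union>l\<in>K. tr l)}))"

definition space :: "'a topology" where
  "space = topology opn"

lemma opn_Int:
  assumes "opn U" "opn V"
  shows "opn (U \<inter> V)"
  unfolding opn_def
proof (intro conjI ballI impI)
  show "U \<inter> V \<subseteq> points" using assms by (auto simp: opn_def)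
next
  fix l assume "l \<in> L \<inter> (U \<inter> V)"
  then have "finite ({n \<in> tr l. p n \<notin> U} \<union> {n \<in> tr l. p n \<notin> V})"
    using assms by (auto simp: opn_def)
  then show "finite {n \<in> tr l. p n \<notin> U \<inter> V}" by (rule rev_finite_subset) auto
next
  assume "w \<in> U \<inter> V"
  then obtain K M where
    K: "K \<subseteq> L" "finite K" "L - K \<subseteq> U" "finite {n. p n \<notin> U \<and> n \<notin> (\<Union>l\<in>K. tr l)}" and
    M: "M \<subseteq> L" "finite M" "L - M \<subseteq> V" "finite {n. p n \<notin> V \<and> n \<notin> (\<Union>l\<in>M. tr l)}"
    using assms unfolding opn_def by blast
  have "finite ({n. p n \<notin> U \<and> n \<notin> (\<Union>l\<in>K. tr l)} \<union> {n. p n \<notin> V \<and> n \<notin> (\<Union>l\<in>M. tr l)})"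
    using K M by blast
  then have "finite {n. p n \<notin> U \<inter> V \<and> n \<notin> (\<Union>l\<in>K \<union> M. tr l)}"
    by (rule rev_finite_subset) auto
  then show "\<exists>K\<subseteq>L. finite K \<and> L - K \<subseteq> U \<inter> V \<and> finite {n. p n \<notin> U \<inter> V \<and> n \<notin> (\<Union>l\<in>K. tr l)}"
    using K M by (intro exI[of _ "K \<union> M"]) blast
qed

lemma opn_Union:
  assumes "\<And>U. U \<in> \<U> \<Longrightarrow> opn U"
  shows "opn (\<Union>\<U>)"
  unfolding opn_def
proof (intro conjI ballI impI)
  show "\<Union>\<U> \<subseteq> points" using assms unfolding opn_def by blast
next
  fix l assume "l \<in> L \<inter> \<Union>\<U>"
  then obtain U where U: "U \<in> \<U>" "l \<in> U" "l \<in> L" by blast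
  then have "finite {n \<in> tr l. p n \<notin> U}" using assms by (auto simp: opn_def)
  then show "finite {n \<in> tr l. p n \<notin> \<Union>\<U>}" by (rule rev_finite_subset) (use U in auto)
next
  assume "w \<in> \<Union>\<U>"
  then obtain U where U: "U \<in> \<U>" "w \<in> U" by blast
  then obtain K where
    K: "K \<subseteq> L" "finite K" "L - K \<subseteq> U" "finite {n. p n \<notin> U \<and> n \<notin> (\<Union>l\<in>K. tr l)}"
    using assms unfolding opn_def by meson
  from K(4) have "finite {n. p n \<notin> \<Union>\<U> \<and> n \<notin> (\<Union>l\<in>K. tr l)}"
    by (rule rev_finite_subset) (use U in auto)
  then show "\<exists>K\<subseteq>L. finite K \<and> L - K \<subseteq> \<Union>\<U> \<and> finite {n. p n \<notin> \<Union>\<U> \<and> n \<notin> (\<Union>l\<in>K. tr l)}"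
    using K U by blast
qed

lemma openin_space: "openin space U \<longleftrightarrow> opn U"
proof -
  have "istopology opn"
    unfolding istopology_def using opn_Int opn_Union by blast
  then show ?thesis by (simp add: space_def topology_inverse')
qed

lemma opn_points: "opn points"
  by (auto simp: opn_def points_def intro: exI[of _ "{}"])

lemma topspace_space [simp]: "topspace space = points"
proof
  show "topspace space \<subseteq> points"
    using openin_topspace[of space] unfolding openin_space by (simp add: opn_def)
  show "points \<subseteq> topspace space"
    using opn_points openin_subset openin_space by blast
qed

lemma opn_singleton: "opn {p n}"
  using p_notin_L p_neq_w by (auto simp: opn_def points_def)

lemma opn_compl_singleton: "opn (points - {p n})"
proof -
  have "{m. p m \<notin> points - {p n}} = {n}" by (auto simp: points_def)
  then show ?thesis using p_notin_L
    by (auto simp: opn_def points_def intro!: exI[of _ "{}"])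
qed

section \<open>Clopen neighbourhoods, separation and compactness\<close>

definition nbhd :: "'a \<Rightarrow> 'a set" where
  "nbhd l = insert l (p ` tr l)"

lemma p_in_nbhd_iff: "l \<in> L \<Longrightarrow> p n \<in> nbhd l \<longleftrightarrow> n \<in> tr l"
  using p_notin_L by (auto simp: nbhd_def)

lemma L_in_nbhd_iff: "m \<in> L \<Longrightarrow> m \<in> nbhd l \<longleftrightarrow> m = l"
  using p_notin_L by (auto simp: nbhd_def)

lemma w_notin_nbhd: "l \<in> L \<Longrightarrow> w \<notin> nbhd l"
  using w_notin_L p_neq_w by (auto simp: nbhd_def)

lemma opn_nbhd:
  assumes "l \<in> L"
  shows "opn (nbhd l)"
proof -
  have "nbhd l \<subseteq> points" using assms by (auto simp: nbhd_def points_def)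
  then show ?thesis
    unfolding opn_def using assms w_notin_nbhd L_in_nbhd_iff by (auto simp: p_in_nbhd_iff)
qed

text \<open>Almost disjointness gives the condition at the other points of \<open>L\<close>; at
  \<open>w\<close> the exceptional set \<open>{l}\<close> absorbs all of
  \<open>tr l\<close>.\<close>

lemma opn_compl_nbhd:
  assumes "l \<in> L"
  shows "opn (points - nbhd l)"
  unfolding opn_def
proof (intro conjI ballI impI)
  have pts: "p n \<in> points" for n by (simp add: points_def)
  fix m assume "m \<in> L \<inter> (points - nbhd l)"
  then have "m \<in> L" "m \<noteq> l" by (auto simp: nbhd_def)
  then have "finite (tr m \<inter> tr l)" using assms almost_disjoint by blast
  then show "finite {n \<in> tr m. p n \<notin> points - nbhd l}"
    by (rule rev_finite_subset) (use assms pts in \<open>auto simp: p_in_nbhd_iff\<close>)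
next
  show "\<exists>K\<subseteq>L. finite K \<and> L - K \<subseteq> points - nbhd l \<and>
      finite {n. p n \<notin> points - nbhd l \<and> n \<notin> (\<Union>l\<in>K. tr l)}"
  proof (intro exI conjI)
    show "{l} \<subseteq> L" using assms by simp
    show "L - {l} \<subseteq> points - nbhd l"
      using L_in_nbhd_iff by (auto simp: points_def)
    have "{n. p n \<notin> points - nbhd l \<and> n \<notin> (\<Union>l\<in>{l}. tr l)} = {}"
      using assms by (auto simp: p_in_nbhd_iff) (auto simp: points_def)
    then show "finite {n. p n \<notin> points - nbhd l \<and> n \<notin> (\<Union>l\<in>{l}. tr l)}"
      by (metis finite.emptyI)
  qed simp
qed auto

text \<open>Of two distinct points one is not \<open>w\<close>, and it has a clopen neighbourhood,
  \<open>{p n}\<close> or \<open>nbhd l\<close>, that misses the other.\<close>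

lemma Hausdorff_space: "Hausdorff_space space"
proof -
  have clopen: "\<exists>U V. opn U \<and> opn V \<and> x \<in> U \<and> y \<in> V \<and> disjnt U V"
    if "x \<in> points" "y \<in> points" "opn K" "opn (points - K)" "x \<in> K \<longleftrightarrow> y \<notin> K" for x y K
    using that by (cases "x \<in> K") (metis Diff_iff Diff_disjoint disjnt_def inf_commute)+
  have "\<exists>U V. opn U \<and> opn V \<and> x \<in> U \<and> y \<in> V \<and> disjnt U V"
    if xy: "x \<in> points" "y \<in> points" "x \<noteq> y" for x y
  proof (cases "x \<in> range p \<or> y \<in> range p")
    case True
    then obtain n where "x = p n \<or> y = p n" by blast
    then show ?thesis
      using clopen[OF xy(1,2) opn_singleton opn_compl_singleton, of n] xy(3) by auto
  next
    case False
    then obtain l where l: "l \<in> L" "x = l \<or> y = l" using xy unfolding points_def by auto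
    then have "x \<in> nbhd l \<longleftrightarrow> y \<notin> nbhd l"
      using False xy(3) by (auto simp: nbhd_def)
    then show ?thesis
      using clopen[OF xy(1,2) opn_nbhd[OF l(1)] opn_compl_nbhd[OF l(1)]] by blast
  qed
  then show ?thesis unfolding Hausdorff_space_def openin_space by simp
qed

lemma compact_space: "compact_space space"
  unfolding compact_space_alt topspace_space
proof (intro allI impI, elim conjE)
  fix \<U> assume op: "\<forall>U\<in>\<U>. openin space U" and cover: "points \<subseteq> \<Union>\<U>"
  have "\<exists>U. U \<in> \<U> \<and> x \<in> U" if "x \<in> points" for x using cover that by blast
  then obtain c where c: "\<And>x. x \<in> points \<Longrightarrow> c x \<in> \<U>" "\<And>x. x \<in> points \<Longrightarrow> x \<in> c x"
    by metis
  have opc: "opn (c x)" if "x \<in> points" for x using c(1)[OF that] op openin_space by blast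
  have w: "w \<in> points" and Lp: "L \<subseteq> points" and pp: "\<And>n. p n \<in> points"
    by (auto simp: points_def)
  obtain K where K: "K \<subseteq> L" "finite K" "L - K \<subseteq> c w"
    "finite {n. p n \<notin> c w \<and> n \<notin> (\<Union>l\<in>K. tr l)}"
    using opc[OF w] c(2)[OF w] unfolding opn_def by blast
  \<comment> \<open>The isolated points missed both by the cover member at \<open>w\<close> and by
    those at the points of \<open>K\<close> have indices in this finite set.\<close>
  define E where "E = {n. p n \<notin> c w \<and> n \<notin> (\<Union>l\<in>K. tr l)} \<union> (\<Union>l\<in>K. {n \<in> tr l. p n \<notin> c l})"
  have "finite {n \<in> tr l. p n \<notin> c l}" if "l \<in> K" for l
    using that K(1) Lp opc[of l] c(2)[of l] unfolding opn_def by blast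
  then have "finite E" using K by (simp add: E_def)
  define \<F> where "\<F> = insert (c w) (c ` K \<union> c ` p ` E)"
  have "finite \<F>" using K \<open>finite E\<close> by (simp add: \<F>_def)
  moreover have "\<F> \<subseteq> \<U>" using c(1) w Lp pp K(1) by (auto simp: \<F>_def)
  moreover have "x \<in> \<Union>\<F>" if x: "x \<in> points" for x
  proof -
    consider n where "x = p n" | "x \<in> K" | "x \<in> L - K" | "x = w"
      using x by (auto simp: points_def)
    then show ?thesis
    proof cases
      case 1
      then show ?thesis
        using c(2)[OF x] by (cases "n \<in> E") (auto simp: \<F>_def E_def)
    next
      case 2
      then show ?thesis using c(2)[OF x] by (auto simp: \<F>_def)
    qed (use K c(2)[OF x] in \<open>auto simp: \<F>_def\<close>)
  qed
  ultimately show "\<exists>\<F>. finite \<F> \<and> \<F> \<subseteq> \<U> \<and> points \<subseteq> \<Union>\<F>" by blast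
qed

lemma separable_space: "separable_space space"
  unfolding separable_space_def topspace_space
proof (intro exI conjI)
  \<comment> \<open>\<open>w\<close> is put in by hand, since the locale admits cases where it is
    isolated. Points of \<open>L\<close> are limits of isolated points because \<open>tr l\<close>
    is infinite.\<close>
  show "countable (insert w (range p))" by simp
  show "insert w (range p) \<subseteq> points" by (auto simp: points_def)
  have meets_L: "\<exists>n. p n \<in> U" if "opn U" "l \<in> L" "l \<in> U" for U l
  proof -
    have "finite {n \<in> tr l. p n \<notin> U}" using that by (auto simp: opn_def)
    then have "{n \<in> tr l. p n \<notin> U} \<noteq> tr l" using infinite_tr[OF that(2)] by metis
    then show ?thesis by blast
  qed
  have "\<exists>y\<in>insert w (range p). y \<in> U" if U: "opn U" "x \<in> U" for U x
  proof (cases "x \<in> L")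
    case True
    then show ?thesis using meets_L[OF U(1) _ U(2)] by blast
  next
    case False
    moreover have "x \<in> points" using U by (auto simp: opn_def)
    ultimately show ?thesis using U(2) by (auto simp: points_def)
  qed
  then show "space closure_of insert w (range p) = points"
    by (fastforce simp: closure_of_def openin_space)
qed

section \<open>Convergence along AP-sets and along finite sums\<close>

lemma van_der_Waerden_space:
  assumes AP: "\<And>f C. AP_set C \<Longrightarrow> finite_fibres_on f C \<Longrightarrow> \<exists>l\<in>L. \<exists>D\<subseteq>C. AP_set D \<and> f ` D \<subseteq> tr l"
  shows "van_der_Waerden_space space"
  unfolding van_der_Waerden_space_def
proof (intro conjI allI impI Hausdorff_space)
  fix x :: "nat \<Rightarrow> 'a" assume "\<forall>n. x n \<in> topspace space"
  then have x: "x n \<in> points" for n by simp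
  obtain D where "D \<subseteq> UNIV" and D: "AP_set D"
    and "(\<exists>y. \<forall>n\<in>D. x n = y) \<or> finite_fibres_on x D"
    by (rule AP_set_canonical[OF AP_set_UNIV])
  then consider y where "\<forall>n\<in>D. x n = y" | "finite_fibres_on x D" by blast
  then show "\<exists>A l. AP_set A \<and> subseq_converges_to space x A l"
  proof cases
    case 1
    obtain m where "m \<in> D" using AP_set_imp_infinite[OF D] by fastforce
    then have "y \<in> points" using 1 x by metis
    moreover have "finite {n \<in> D. x n \<notin> U}" if "y \<in> U" for U
    proof -
      have "{n \<in> D. x n \<notin> U} = {}" using 1 that by auto
      then show ?thesis by (metis finite.emptyI)
    qed
    ultimately have "subseq_converges_to space x D y"
      by (simp add: subseq_converges_to_def)
    then show ?thesis using D by blast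
  next
    case 2
    have "AP_set {n \<in> D. x n \<in> range p} \<or> AP_set {n \<in> D. x n \<notin> range p}"
      by (rule AP_set_Un) (rule AP_set_mono[OF D], blast)
    then show ?thesis
    proof
      assume C: "AP_set {n \<in> D. x n \<in> range p}" (is "AP_set ?C")
      \<comment> \<open>On \<open>?C\<close> the sequence is \<open>p \<circ> g\<close> with
        \<open>g\<close> finite-to-one, so \<open>AP\<close> applies to \<open>g\<close>. Finite
        fibres then turn finitely many exceptional indices in \<open>tr l\<close> into finitely many
        exceptional terms.\<close>
      define g where "g n = inv p (x n)" for n
      have g: "p (g n) = x n" if "n \<in> ?C" for n
        using that by (auto simp: g_def f_inv_into_f)
      have fin_g: "finite_fibres_on g ?C"
        unfolding finite_fibres_on_def
      proof
        fix y
        have "finite {n \<in> D. x n = p y}" using 2 unfolding finite_fibres_on_def by blast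
        then show "finite {n \<in> ?C. g n = y}"
          by (rule rev_finite_subset) (use g in auto)
      qed
      obtain l E where E: "l \<in> L" "E \<subseteq> ?C" "AP_set E" "g ` E \<subseteq> tr l"
        using AP[OF C fin_g] by blast
      have "finite {n \<in> E. x n \<notin> U}" if "opn U" "l \<in> U" for U
      proof -
        have "finite {m \<in> tr l. p m \<notin> U}" using that E(1) by (auto simp: opn_def)
        then have "finite {n \<in> E. g n \<in> {m \<in> tr l. p m \<notin> U}}"
          using finite_fibres_on_vimage finite_fibres_on_subset[OF fin_g E(2)] by blast
        moreover have "g n \<in> {m \<in> tr l. p m \<notin> U}" if "n \<in> E" "x n \<notin> U" for n
          using that g[of n] E(2,4) by auto
        then have "{n \<in> E. x n \<notin> U} \<subseteq> {n \<in> E. g n \<in> {m \<in> tr l. p m \<notin> U}}" by blast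
        ultimately show ?thesis by (rule rev_finite_subset)
      qed
      then have "subseq_converges_to space x E l"
        using E(1) by (simp add: subseq_converges_to_def openin_space points_def)
      then show ?thesis using E(3) by blast
    next
      assume C: "AP_set {n \<in> D. x n \<notin> range p}" (is "AP_set ?C")
      have "finite {n \<in> ?C. x n \<notin> U}" if U: "opn U" "w \<in> U" for U
      proof -
        obtain K where K: "finite K" "L - K \<subseteq> U" using U by (auto simp: opn_def)
        \<comment> \<open>A non-isolated point outside \<open>U\<close> lies in the finite set
          \<open>K\<close>, and each value is taken finitely often.\<close>
        have "finite {n \<in> D. x n \<in> K}" using 2 K(1) finite_fibres_on_vimage by blast
        moreover have "{n \<in> ?C. x n \<notin> U} \<subseteq> {n \<in> D. x n \<in> K}"
        proof
          fix n assume "n \<in> {n \<in> ?C. x n \<notin> U}"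
          then show "n \<in> {n \<in> D. x n \<in> K}"
            using x[of n] K(2) U(2) by (auto simp: points_def)
        qed
        ultimately show ?thesis by (rule rev_finite_subset)
      qed
      then have "subseq_converges_to space x ?C w"
        by (simp add: subseq_converges_to_def openin_space points_def)
      then show ?thesis using C by blast
    qed
  qed
qed

lemma not_Hindman_space:
  assumes thin: "\<And>l. l \<in> L \<Longrightarrow> thin (tr l)"
    and maximal: "\<And>B. infinite B \<Longrightarrow> \<exists>l\<in>L. infinite (tr l \<inter> B)"
  shows "\<not> Hindman_space space"
proof
  assume "Hindman_space space"
  moreover have "\<forall>n. p n \<in> topspace space" by (simp add: points_def)
  ultimately obtain B x where B: "infinite B" "IP_converges_to space p B x"
    unfolding Hindman_space_def by meson
  have conv: "\<exists>k. \<forall>m\<in>FS (B - {0..<k}). p m \<in> U" if "opn U" "x \<in> U" for U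
    using B(2) that by (auto simp: IP_converges_to_def openin_space)
  have inf: "infinite (B - {0..<k})" for k using B(1) by simp
  have "x \<in> points" using B(2) by (simp add: IP_converges_to_def)
  then consider n where "x = p n" | "x \<in> L" | "x = w" unfolding points_def by blast
  then show False
  proof cases
    case 1
    then obtain k where "\<forall>m\<in>FS (B - {0..<k}). p m \<in> {p n}"
      using conv opn_singleton by blast
    then have "B - {0..<k} \<subseteq> {n}" using subset_FS[of "B - {0..<k}"] by auto
    then show False using inf finite_subset by blast
  next
    case 2
    then obtain k where "\<forall>m\<in>FS (B - {0..<k}). p m \<in> nbhd x"
      using conv[OF opn_nbhd[OF 2]] by (auto simp: nbhd_def)
    then have "FS (B - {0..<k}) \<subseteq> tr x" using p_in_nbhd_iff[OF 2] by blast
    then show False using not_FS_subset_thin[OF thin[OF 2] inf] by blast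
  next
    case 3
    \<comment> \<open>The complement of \<open>nbhd l\<close> is a neighbourhood of
      \<open>w\<close>, but every tail of \<open>B\<close> meets \<open>tr l\<close>.\<close>
    obtain l where l: "l \<in> L" "infinite (tr l \<inter> B)" using maximal B(1) by blast
    have "x \<in> points - nbhd l" using 3 w_notin_nbhd[OF l(1)] by (simp add: points_def)
    then obtain k where k: "\<forall>m\<in>FS (B - {0..<k}). p m \<in> points - nbhd l"
      using conv[OF opn_compl_nbhd[OF l(1)]] by blast
    have "tr l \<inter> B \<subseteq> {0..<k}"
      using k subset_FS[of "B - {0..<k}"] p_in_nbhd_iff[OF l(1)] by blast
    then show False using l(2) finite_subset by blast
  qed
qed

end

theorem theorem2p2:
  assumes "CH"
  shows "\<exists>X :: real set topology.
           compact_space X \<and> separable_space X \<and> Hausdorff_space X \<and>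
           van_der_Waerden_space X \<and> \<not> Hindman_space X"
proof -
  obtain \<A> where inf_thin: "\<forall>A\<in>\<A>. infinite A \<and> thin A"
    and ad: "\<forall>A\<in>\<A>. \<forall>B\<in>\<A>. A \<noteq> B \<longrightarrow> finite (A \<inter> B)"
    and AP: "\<forall>f C. AP_set C \<and> finite_fibres_on f C \<longrightarrow> (\<exists>A\<in>\<A>. \<exists>D\<subseteq>C. AP_set D \<and> f ` D \<subseteq> A)"
    by (rule CH_almost_disjoint_family[OF assms])
  have maximal: "\<exists>A\<in>\<A>. infinite (A \<inter> B)" if "infinite B" for B
  proof -
    have "finite_fibres_on (enumerate B) UNIV"
      unfolding finite_fibres_on_def
    proof
      fix y
      \<comment> \<open>The increasing enumeration satisfies
        \<open>n \<le> enumerate B n\<close>.\<close>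
      have "{n \<in> UNIV. enumerate B n = y} \<subseteq> {..y}"
        using le_enumerate[OF that] by auto
      then show "finite {n \<in> UNIV. enumerate B n = y}" using finite_subset by blast
    qed
    note fin = this
    then obtain A D where D: "A \<in> \<A>" "AP_set D" "enumerate B ` D \<subseteq> A"
      using AP AP_set_UNIV by blast
    have "infinite (enumerate B ` D)"
      using AP_set_imp_infinite[OF D(2)] finite_fibres_on_subset[OF fin] finite_fibres_on_infinite_image
      by blast
    moreover have "enumerate B ` D \<subseteq> A \<inter> B" using D(3) enumerate_in_set[OF that] by blast
    ultimately show ?thesis using D(1) finite_subset by blast
  qed
  define tr :: "real set \<Rightarrow> nat set" where "tr S = {n. real n \<in> S}" for S
  have tr [simp]: "tr (real ` A) = A" for A by (auto simp: tr_def)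
  \<comment> \<open>All points are coded as sets of reals: naturals as singletons, members of the
    family as infinite sets, infinity as the empty set. The three kinds differ in
    cardinality.\<close>
  interpret mrowka "\<lambda>n. {real n}" "(`) real ` \<A>" tr "{}"
  proof
    show "{real n} \<notin> (`) real ` \<A>" for n
    proof
      assume "{real n} \<in> (`) real ` \<A>"
      then obtain A where "A \<in> \<A>" "real ` A = {real n}" by auto
      then show False using inf_thin by (metis finite.emptyI finite_imageD finite_insert inj_on_of_nat)
    qed
    show "finite (tr l \<inter> tr m)"
      if "l \<in> (`) real ` \<A>" "m \<in> (`) real ` \<A>" "l \<noteq> m" for l m
    proof -
      obtain A B where "A \<in> \<A>" "B \<in> \<A>" "l = real ` A" "m = real ` B" using \<open>l \<in> _\<close> \<open>m \<in> _\<close> by blast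
      then show ?thesis using ad \<open>l \<noteq> m\<close> by auto
    qed
  qed (use inf_thin in \<open>auto simp: inj_def\<close>)
  show ?thesis
  proof (intro exI conjI)
    show "van_der_Waerden_space space"
    proof (rule van_der_Waerden_space)
      fix f :: "nat \<Rightarrow> nat" and C assume "AP_set C" "finite_fibres_on f C"
      then obtain A where "A \<in> \<A>" "\<exists>D\<subseteq>C. AP_set D \<and> f ` D \<subseteq> A"
        using AP[rule_format, OF conjI] by metis
      then show "\<exists>l\<in>(`) real ` \<A>. \<exists>D\<subseteq>C. AP_set D \<and> f ` D \<subseteq> tr l"
        by (intro bexI[of _ "real ` A"]) auto
    qed
    show "\<not> Hindman_space space"
    proof (rule not_Hindman_space)
      show "thin (tr l)" if "l \<in> (`) real ` \<A>" for l
        using that inf_thin by auto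
      show "\<exists>l\<in>(`) real ` \<A>. infinite (tr l \<inter> B)" if "infinite B" for B
        using maximal[OF that] by simp
    qed
  qed (fact compact_space separable_space Hausdorff_space)+
qed

end
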